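(* Let $3\le k<n$ be integers. Let $V$ be a set of words of length $n$ over the alphabet $\{0,1,*\}$ satisfying the following conditions: (1) for every $v\in V$, exactly $k$ of the letters $v_1,\dots,v_n$ belong to $\{0,1\}$ (equivalently, the box encoded by $v$ has cardinality $2^{n-k}$); (2) if $u,v\in V$ are distinct, then there is exactly one index $i\in\{1,\dots,n\}$ such that $\{v_i,u_i\}=\{0,1\}$; (3) if $u,v\in V$ are distinct, then $\{i: u_i\in\{0,1\}\}\neq\{i: v_i\in\{0,1\}\}$. Then $|V|\le 2^k-2$.
   Context: A word $w=w_1\cdots w_n$ over $\{0,1,*\}$ encodes the box $B_1\times\cdots\times B_n\subseteq\{0,1\}^n$, where $B_i=\{0\}$ if $w_i=0$, $B_i=\{1\}$ if $w_i=1$, and $B_i=\{0,1\}$ if $w_i=*$; $|w|$ denotes the cardinality of this box. *)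

theory Defs
  imports Main
begin

text \<open>
  A word is a list of letters; list positions are numbered from 0, so the letter
  \<open>w\<^sub>i\<close> (for \<open>1 \<le> i \<le> n\<close>) is \<open>w ! (i - 1)\<close>.
\<close>

datatype letter = Zero | One | Star

definition fixed_positions :: "letter list \<Rightarrow> nat set" where
  "fixed_positions w = {i. i < length w \<and> w ! i \<in> {Zero, One}}"

end

theory Submission
  imports Defs
begin

text \<open>
  Points of the cube are subsets of \<open>{..<n}\<close> and Fourier analysis is done with the characters
  \<open>\<chi>\<^sub>T(X) = (-1)\<^bsup>|T \<inter> X|\<^esup>\<close>. Let \<open>C\<close> be the set of points outside all boxes. For \<open>T\<close> the support of
  a word \<open>v\<close>, only the box of \<open>v\<close> itself correlates with \<open>\<chi>\<^sub>T\<close>, because supports are distinct and have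
  equal size; hence \<open>\<bar>\<Sum>\<^bsub>X \<in> C\<^esub> \<chi>\<^sub>T(X)\<bar> = 2\<^bsup>n - k\<^esup>\<close>. This excludes \<open>|V| = 2\<^sup>k\<close>, where \<open>C\<close> is empty. If
  \<open>|V| = 2\<^sup>k - 1\<close>, then \<open>|C| = 2\<^bsup>n - k\<^esup>\<close>, so every such \<open>\<chi>\<^sub>T\<close> is constant on \<open>C\<close>, and equality in
  Parseval's identity shows that the indicator of \<open>C\<close> has spectrum exactly the family \<open>F\<close> of supports
  together with \<open>{}\<close>, with all coefficients \<open>\<plusminus>2\<^bsup>-k\<^esup>\<close>. Flipping a coordinate \<open>i\<close> of a point of \<open>C\<close> shows
  that \<open>i\<close> lies in \<open>0\<close> or \<open>2\<^bsup>k - 1\<^esup>\<close> members of \<open>F\<close>, so \<open>2\<^bsup>k - 1\<^esup>\<close> divides \<open>\<Sum>\<^bsub>T \<in> F\<^esub> |T| = (2\<^sup>k - 1) k\<close>,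
  which is impossible for \<open>k \<ge> 3\<close>.
\<close>

section \<open>Characters of the cube under coordinate flips\<close>

definition chi :: "nat set \<Rightarrow> nat set \<Rightarrow> int" where
  "chi T X = (- 1) ^ card (T \<inter> X)"

definition flip :: "nat \<Rightarrow> nat set \<Rightarrow> nat set" where
  "flip i X = (if i \<in> X then X - {i} else insert i X)"

lemma flip_flip [simp]: "flip i (flip i X) = X"
  by (auto simp: flip_def)

lemma flip_subset_iff [simp]: "i \<in> A \<Longrightarrow> flip i X \<subseteq> A \<longleftrightarrow> X \<subseteq> A"
  by (auto simp: flip_def split: if_splits)

lemma chi_empty [simp]: "chi {} X = 1"
  by (simp add: chi_def)

lemma chi_cases: "chi T X = 1 \<or> chi T X = - 1"
  by (simp add: chi_def neg_one_even_power uminus_power_if)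

lemma chi_mult_self [simp]: "chi T X * chi T X = 1"
  using chi_cases[of T X] by auto

lemma chi_flip:
  assumes "finite T"
  shows "chi T (flip i X) = (if i \<in> T then - chi T X else chi T X)"
proof (cases "i \<in> T")
  case True
  have *: "card (T \<inter> insert i Y) = Suc (card (T \<inter> (Y - {i})))" for Y
  proof -
    have "T \<inter> insert i Y = insert i (T \<inter> (Y - {i}))"
      using True by auto
    then show ?thesis
      using assms by simp
  qed
  show ?thesis
    using True *[of X] by (auto simp: chi_def flip_def insert_absorb)
next
  case False
  then have "T \<inter> flip i X = T \<inter> X"
    by (auto simp: flip_def)
  with False show ?thesis
    by (simp add: chi_def)
qed

text \<open>Flipping \<open>i\<close> is an involution of \<open>B\<close>, so reindexing along it
  shows that the sum equals its own negative.\<close>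

lemma sum_flip_antisym:
  fixes h :: "nat set \<Rightarrow> int"
  assumes "\<And>X. X \<in> B \<Longrightarrow> flip i X \<in> B" and "\<And>X. X \<in> B \<Longrightarrow> h (flip i X) = - h X"
  shows "sum h B = 0"
proof -
  have "sum h B = (\<Sum>X\<in>B. - h X)"
    by (rule sum.reindex_bij_witness[of B "flip i" "flip i"]) (use assms in auto)
  then show ?thesis
    by (simp add: sum_negf)
qed

text \<open>If \<open>S\<close> and \<open>T\<close> differ at \<open>i\<close>, flipping
  \<open>i\<close> changes the sign of exactly one of the two factors.\<close>

lemma chi_orthogonal:
  assumes "finite A" "S \<subseteq> A" "T \<subseteq> A"
  shows "(\<Sum>X\<in>Pow A. chi S X * chi T X) = (if S = T then 2 ^ card A else 0)"
proof (cases "S = T")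
  case True
  then show ?thesis
    by (simp add: card_Pow assms)
next
  case False
  then obtain i where i: "i \<in> S \<longleftrightarrow> i \<notin> T"
    by blast
  then have "i \<in> A"
    using assms by blast
  have "finite S" "finite T"
    using assms finite_subset by auto
  then have "(\<Sum>X\<in>Pow A. chi S X * chi T X) = 0"
    using i \<open>i \<in> A\<close> by (intro sum_flip_antisym[of _ i]) (simp_all add: chi_flip)
  with False show ?thesis
    by simp
qed

text \<open>Equality in the triangle inequality: \<open>1 - h\<close> or \<open>1 + h\<close> is a
  nonnegative function with sum zero, so it vanishes on \<open>C\<close>.\<close>

lemma sum_sign_eq_card:
  fixes h :: "'a \<Rightarrow> int"
  assumes "finite C" and "\<And>x. x \<in> C \<Longrightarrow> h x = 1 \<or> h x = - 1"
    and "\<bar>sum h C\<bar> = int (card C)" and "x \<in> C" "y \<in> C"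
  shows "h x = h y"
proof -
  have "(\<Sum>x\<in>C. 1 - h x) = 0 \<or> (\<Sum>x\<in>C. 1 + h x) = 0"
    using assms(3) by (auto simp: sum_subtractf sum.distrib)
  then have "(\<forall>x\<in>C. 1 - h x = 0) \<or> (\<forall>x\<in>C. 1 + h x = 0)"
    using assms(1,2) by (subst (asm) (1 2) sum_nonneg_eq_0_iff) force+
  then have "1 - h x = 0 \<and> 1 - h y = 0 \<or> 1 + h x = 0 \<and> 1 + h y = 0"
    using assms(4,5) by blast
  then show ?thesis
    by linarith
qed

text \<open>
  Equality in Parseval's identity: \<open>C\<close> is so large that the characters in \<open>F\<close>, being constant on
  it, exhaust the spectrum of its indicator function.
\<close>

lemma indicator_eq_char_sum:
  assumes "finite A" and "F \<subseteq> Pow A" and "C \<subseteq> Pow A"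
    and "card C * card F = 2 ^ card A"
    and const: "\<And>T X. T \<in> F \<Longrightarrow> X \<in> C \<Longrightarrow> chi T X = chi T X0"
    and "X \<in> Pow A"
  shows "(\<Sum>T\<in>F. chi T X0 * chi T X) = (if X \<in> C then int (card F) else 0)"
proof -
  define g where "g X = (\<Sum>T\<in>F. chi T X0 * chi T X)" for X
  define f where "f X = (if X \<in> C then int (card F) else 0)" for X
  have fin: "finite F" "finite (Pow A)"
    using assms(1,2) finite_subset by auto
  have PC: "Pow A \<inter> C = C"
    using assms(3) by blast
  have gC: "g X = int (card F)" if "X \<in> C" for X
    using const[OF _ that] by (simp add: g_def)
  have ff: "(\<Sum>X\<in>Pow A. f X * f X) = int (card F) * 2 ^ card A"
  proof -
    have "(\<Sum>X\<in>Pow A. f X * f X) = (\<Sum>X\<in>Pow A. if X \<in> C then int (card F) ^ 2 else 0)"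
      by (rule sum.cong) (auto simp: f_def power2_eq_square)
    also have "\<dots> = int (card F) * int (card C * card F)"
      using fin by (simp add: sum.If_cases PC power2_eq_square)
    finally show ?thesis
      using assms(4) by simp
  qed
  have fg: "f X * g X = f X * f X" for X
    using gC by (simp add: f_def)
  have "(\<Sum>X\<in>Pow A. g X * g X)
      = (\<Sum>X\<in>Pow A. \<Sum>S\<in>F. \<Sum>T\<in>F. chi S X0 * chi T X0 * (chi S X * chi T X))"
    by (simp add: g_def sum_product algebra_simps)
  also have "\<dots> = (\<Sum>S\<in>F. \<Sum>T\<in>F. \<Sum>X\<in>Pow A. chi S X0 * chi T X0 * (chi S X * chi T X))"
    by (subst sum.swap, rule sum.cong[OF refl], rule sum.swap)
  also have "\<dots> = (\<Sum>S\<in>F. \<Sum>T\<in>F. if S = T then 2 ^ card A else 0)"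
    unfolding sum_distrib_left[symmetric]
  proof (intro sum.cong refl)
    fix S T assume "S \<in> F" "T \<in> F"
    then have "(\<Sum>X\<in>Pow A. chi S X * chi T X) = (if S = T then 2 ^ card A else 0)"
      using assms(1,2) by (intro chi_orthogonal) auto
    then show "chi S X0 * chi T X0 * (\<Sum>X\<in>Pow A. chi S X * chi T X)
        = (if S = T then 2 ^ card A else 0)"
      by simp
  qed
  also have "\<dots> = int (card F) * 2 ^ card A"
    using fin by simp
  finally have gg: "(\<Sum>X\<in>Pow A. g X * g X) = int (card F) * 2 ^ card A" .
  \<comment> \<open>The inner products of \<open>f\<close> with \<open>f\<close>, \<open>f\<close>
    with \<open>g\<close> and \<open>g\<close> with \<open>g\<close> all coincide, so the squared
    distance is zero.\<close>
  have "(\<Sum>X\<in>Pow A. (g X - f X)\<^sup>2)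
      = (\<Sum>X\<in>Pow A. g X * g X) - 2 * (\<Sum>X\<in>Pow A. f X * g X) + (\<Sum>X\<in>Pow A. f X * f X)"
    by (simp add: sum.distrib sum_subtractf sum_distrib_left power2_eq_square algebra_simps)
  also have "\<dots> = 0"
    by (simp add: fg ff gg)
  finally have "\<forall>X\<in>Pow A. (g X - f X)\<^sup>2 = 0"
    using fin by (subst (asm) sum_nonneg_eq_0_iff) auto
  then show ?thesis
    using assms(6) by (simp add: f_def g_def)
qed

text \<open>Evaluate the character sum at \<open>flip i X0\<close>: members of \<open>F\<close>
  containing \<open>i\<close> contribute -1 and all others 1, while the total can only be 0 or
  \<open>card F\<close>.\<close>

lemma constant_chars_degree:
  assumes "finite A" and "F \<subseteq> Pow A" and "C \<subseteq> Pow A"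
    and "card C * card F = 2 ^ card A"
    and "\<And>T X. T \<in> F \<Longrightarrow> X \<in> C \<Longrightarrow> chi T X = chi T X0"
    and "X0 \<in> C" and "i \<in> A"
  shows "2 * card {T \<in> F. i \<in> T} = 0 \<or> 2 * card {T \<in> F. i \<in> T} = card F"
proof -
  have fin: "finite F" "\<And>T. T \<in> F \<Longrightarrow> finite T"
    using assms(1,2) by (meson finite_Pow_iff finite_subset, meson PowD finite_subset subsetD)
  have "flip i X0 \<in> Pow A"
    using assms(3,6,7) by auto
  note indicator_eq_char_sum[OF assms(1-5) this]
  moreover have "(\<Sum>T\<in>F. chi T X0 * chi T (flip i X0)) = (\<Sum>T\<in>F. 1 - 2 * (if i \<in> T then 1 else 0))"
    by (rule sum.cong) (auto simp: chi_flip fin)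
  moreover have "\<dots> = int (card F) - 2 * int (card {T \<in> F. i \<in> T})"
    using fin by (simp add: sum_subtractf sum_distrib_left[symmetric] sum.If_cases Int_def)
  ultimately show ?thesis
    by (auto split: if_splits)
qed

section \<open>Boxes and their character sums\<close>

definition ones :: "letter list \<Rightarrow> nat set" where
  "ones w = {i. i < length w \<and> w ! i = One}"

text \<open>A set \<open>X\<close> stands for the point whose coordinates equal to 1 are those in
  \<open>X\<close>; starred positions stay unconstrained.\<close>

definition box :: "letter list \<Rightarrow> nat set set" where
  "box w = {X. X \<subseteq> {..<length w} \<and> fixed_positions w \<inter> X = ones w}"

lemma fixed_positions_subset: "fixed_positions w \<subseteq> {..<length w}"
  by (auto simp: fixed_positions_def)

lemma ones_subset: "ones w \<subseteq> fixed_positions w"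
  by (auto simp: fixed_positions_def ones_def)

lemma finite_box [simp]: "finite (box w)"
  by (rule finite_subset[of _ "Pow {..<length w}"]) (auto simp: box_def)

lemma card_box: "card (box w) = 2 ^ (length w - card (fixed_positions w))"
proof -
  let ?R = "{..<length w} - fixed_positions w"
  have "card (box w) = card (Pow ?R)"
    by (rule bij_betw_same_card[of "\<lambda>X. X - fixed_positions w"],
        rule bij_betw_byWitness[where f' = "\<lambda>Y. Y \<union> ones w"])
      (use ones_subset[of w] fixed_positions_subset[of w] in \<open>auto simp: box_def\<close>)
  also have "\<dots> = 2 ^ (length w - card (fixed_positions w))"
    using fixed_positions_subset[of w] by (simp add: card_Pow card_Diff_subset finite_subset)
  finally show ?thesis .
qed

lemma box_disjoint:
  assumes "i < length u" "length u = length v" "{v ! i, u ! i} = {Zero, One}"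
  shows "box u \<inter> box v = {}"
proof (rule ccontr)
  assume "box u \<inter> box v \<noteq> {}"
  then obtain X where "fixed_positions u \<inter> X = ones u" "fixed_positions v \<inter> X = ones v"
    by (auto simp: box_def)
  then have "i \<in> X \<longleftrightarrow> u ! i = One" "i \<in> X \<longleftrightarrow> v ! i = One"
    using assms by (auto simp: fixed_positions_def ones_def doubleton_eq_iff)
  then show False
    using assms(3) by (auto simp: doubleton_eq_iff)
qed

text \<open>On its own box the character is constant, since
  \<open>fixed_positions v \<inter> X\<close> is always \<open>ones v\<close>.\<close>

lemma sum_chi_box_self: "\<bar>\<Sum>X\<in>box v. chi (fixed_positions v) X\<bar> = int (card (box v))"
proof -
  have "(\<Sum>X\<in>box v. chi (fixed_positions v) X) = (\<Sum>X\<in>box v. (- 1) ^ card (ones v))"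
    by (rule sum.cong) (auto simp: chi_def box_def)
  then show ?thesis
    by (simp add: abs_mult power_abs)
qed

text \<open>Flipping a position of \<open>T\<close> that is free in \<open>u\<close> preserves the
  box and negates the character.\<close>

lemma sum_chi_box_zero:
  assumes "T \<subseteq> {..<length u}" "\<not> T \<subseteq> fixed_positions u"
  shows "(\<Sum>X\<in>box u. chi T X) = 0"
proof -
  obtain i where i: "i \<in> T" "i \<notin> fixed_positions u"
    using assms(2) by blast
  have "finite T"
    using assms(1) finite_subset by blast
  moreover have "flip i X \<in> box u" if "X \<in> box u" for X
    using that i assms(1) by (auto simp: box_def flip_def)
  ultimately show ?thesis
    using i(1) by (intro sum_flip_antisym[of _ i]) (auto simp: chi_flip)
qed

section \<open>Counting the uncovered points and their spectrum\<close>

theorem theorem1: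
  fixes k n :: nat and V :: "letter list set"
  assumes "3 \<le> k" and "k < n"
    and "\<And>v. v \<in> V \<Longrightarrow> length v = n"
    and "\<And>v. v \<in> V \<Longrightarrow> card (fixed_positions v) = k"
    and "\<And>u v. u \<in> V \<Longrightarrow> v \<in> V \<Longrightarrow> u \<noteq> v \<Longrightarrow>
           \<exists>!i. i < n \<and> {v ! i, u ! i} = {Zero, One}"
    and "\<And>u v. u \<in> V \<Longrightarrow> v \<in> V \<Longrightarrow> u \<noteq> v \<Longrightarrow>
           fixed_positions u \<noteq> fixed_positions v"
  shows "card V \<le> 2 ^ k - 2"
proof (rule ccontr)
  assume "\<not> card V \<le> 2 ^ k - 2"
  then have large: "card V \<ge> 2 ^ k - 1"
    by simp
  let ?A = "{..<n}" and ?S = fixed_positions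
  define C where "C = Pow ?A - (\<Union>v\<in>V. box v)"
  have S_sub: "?S v \<subseteq> ?A" if "v \<in> V" for v
    using fixed_positions_subset[of v] assms(3)[OF that] by simp
  have S_fin: "finite (?S v)" if "v \<in> V" for v
    using S_sub[OF that] finite_subset by blast
  have S_ne: "?S v \<noteq> {}" if "v \<in> V" for v
    using assms(1) assms(4)[OF that] by auto
  have S_inj: "inj_on ?S V"
    using assms(6) by (meson inj_onI)
  have "finite (?S ` V)"
    by (rule finite_subset[of _ "Pow ?A"]) (use S_sub in auto)
  then have finV: "finite V"
    using S_inj finite_imageD by blast
  have disj: "box u \<inter> box v = {}" if uv: "u \<in> V" "v \<in> V" "u \<noteq> v" for u v
  proof -
    obtain i where "i < n" "{v ! i, u ! i} = {Zero, One}"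
      using assms(5)[OF uv] by blast
    then show ?thesis
      using assms(3) uv by (intro box_disjoint) auto
  qed
  have U_sub: "(\<Union>v\<in>V. box v) \<subseteq> Pow ?A"
    using assms(3) by (auto simp: box_def)
  have cbox: "card (box v) = 2 ^ (n - k)" if "v \<in> V" for v
    using assms(3,4)[OF that] by (simp add: card_box)
  have C_fin: "finite C" and C_sub: "C \<subseteq> Pow ?A"
    by (auto simp: C_def)
  have split: "sum h (Pow ?A) = sum h C + (\<Sum>v\<in>V. sum h (box v))" for h :: "nat set \<Rightarrow> int"
  proof -
    have "sum h (\<Union>v\<in>V. box v) = (\<Sum>v\<in>V. sum h (box v))"
      using finV disj by (intro sum.UNION_disjoint) auto
    then show ?thesis
      using sum.subset_diff[OF U_sub, of h] by (simp add: C_def)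
  qed
  have two_n: "(2::nat) ^ n = 2 ^ k * 2 ^ (n - k)"
    using assms(2) by (simp flip: power_add)
  have "int (2 ^ n) = int (card C) + int (card V * 2 ^ (n - k))"
    using split[of "\<lambda>_. 1"] cbox by (simp add: card_Pow)
  then have "2 ^ n = card C + card V * 2 ^ (n - k)"
    by (simp only: of_nat_add[symmetric] of_nat_eq_iff)
  then have cardC: "card C = (2 ^ k - card V) * 2 ^ (n - k)"
    by (simp add: two_n diff_mult_distrib)
  have sumC: "\<bar>\<Sum>X\<in>C. chi (?S v) X\<bar> = 2 ^ (n - k)" if v: "v \<in> V" for v
  proof -
    have "(\<Sum>X\<in>Pow ?A. chi (?S v) X) = 0"
      using chi_orthogonal[of ?A "?S v" "{}"] S_sub[OF v] S_ne[OF v] by simp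
    moreover have "(\<Sum>u\<in>V - {v}. \<Sum>X\<in>box u. chi (?S v) X) = 0"
    proof (rule sum.neutral, rule ballI)
      fix u assume u: "u \<in> V - {v}"
      \<comment> \<open>Both supports have size \<open>k\<close>, so inclusion would force
        equality.\<close>
      have "\<not> ?S v \<subseteq> ?S u"
        using card_subset_eq[of "?S u" "?S v"] S_fin assms(4,6) u v by auto
      then show "(\<Sum>X\<in>box u. chi (?S v) X) = 0"
        using S_sub[OF v] assms(3) u by (intro sum_chi_box_zero) auto
    qed
    ultimately have "(\<Sum>X\<in>C. chi (?S v) X) = - (\<Sum>X\<in>box v. chi (?S v) X)"
      using split[of "chi (?S v)"] sum.remove[OF finV v, of "\<lambda>u. \<Sum>X\<in>box u. chi (?S v) X"]
      by simp
    then show ?thesis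
      using sum_chi_box_self[of v] cbox[OF v] by simp
  qed
  have "(2::nat) ^ 3 \<le> 2 ^ k"
    using assms(1) by (intro power_increasing) auto
  then have k8: "(8::nat) \<le> 2 ^ k"
    by simp
  then obtain v0 where v0: "v0 \<in> V"
    using large by (cases "V = {}") auto
  have "C \<noteq> {}"
    using sumC[OF v0] by auto
  then obtain X0 where X0: "X0 \<in> C"
    by blast
  have "card C \<noteq> 0"
    using X0 C_fin by auto
  \<comment> \<open>A nonempty \<open>C\<close> makes the truncated difference in
    \<open>cardC\<close> positive, so \<open>card V < 2 ^ k\<close>.\<close>
  then have cardV: "card V = 2 ^ k - 1"
    using large unfolding cardC by auto
  then have cardC': "card C = 2 ^ (n - k)"
    using k8 unfolding cardC by simp
  \<comment> \<open>Adding the trivial character raises the size to \<open>2 ^ k\<close>, so that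
    \<open>card C * card F\<close> is exactly \<open>2 ^ n\<close>.\<close>
  define F where "F = insert {} (?S ` V)"
  have F_sub: "F \<subseteq> Pow ?A"
    using S_sub by (auto simp: F_def)
  have F_fin: "finite F"
    using finV by (simp add: F_def)
  have emp: "{} \<notin> ?S ` V"
    using S_ne by (metis imageE)
  have cardF: "card F = 2 ^ k"
    using finV emp k8 by (simp add: F_def card_image[OF S_inj] cardV)
  have const: "chi T X = chi T X0" if TX: "T \<in> F" "X \<in> C" for T X
  proof (cases "T = {}")
    case False
    then obtain v where v: "v \<in> V" "T = ?S v"
      using TX False by (auto simp: F_def)
    have "\<bar>sum (chi T) C\<bar> = int (card C)"
      using sumC[OF v(1)] v(2) cardC' by simp
    then show ?thesis
      by (rule sum_sign_eq_card[OF C_fin chi_cases _ TX(2) X0])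
  qed simp
  have dvd: "2 ^ (k - 1) dvd card {T \<in> F. i \<in> T}" if "i \<in> ?A" for i
  proof -
    have "card C * card F = 2 ^ card ?A"
      using cardC' cardF two_n by simp
    then have "2 * card {T \<in> F. i \<in> T} = 0 \<or> 2 * card {T \<in> F. i \<in> T} = card F"
      by (rule constant_chars_degree[OF finite_lessThan F_sub C_sub _ const X0 that])
    moreover have "card F = 2 * 2 ^ (k - 1)"
      using assms(1) cardF by (simp flip: power_Suc)
    ultimately show ?thesis
      by auto
  qed
  \<comment> \<open>Double counting of the pairs \<open>i \<in> T\<close> with
    \<open>T \<in> F\<close>; the empty set contributes nothing.\<close>
  have "(\<Sum>T\<in>F. card T) = (\<Sum>v\<in>V. card (?S v))"
    using finV emp by (simp add: F_def sum.reindex[OF S_inj])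
  also have "\<dots> = (2 ^ k - 1) * k"
    using assms(4) cardV by simp
  finally have "(2 ^ k - 1) * k = (\<Sum>T\<in>F. card T)" ..
  also have "\<dots> = (\<Sum>T\<in>F. \<Sum>i\<in>?A. if i \<in> T then 1 else 0)"
    using F_sub by (intro sum.cong) (auto simp: sum.If_cases Int_absorb1)
  also have "\<dots> = (\<Sum>i\<in>?A. card {T \<in> F. i \<in> T})"
    using F_fin by (subst sum.swap) (simp add: sum.If_cases Int_def)
  finally have "2 ^ (k - 1) dvd (2 ^ k - 1) * k"
    using dvd by (metis (no_types, lifting) dvd_sum)
  moreover have "coprime (2 ^ (k - 1)) (2 ^ k - 1 :: nat)"
    using assms(1) by simp
  ultimately have "2 ^ (k - 1) dvd k"
    by (simp add: coprime_dvd_mult_right_iff)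
  then have "2 ^ (k - 1) \<le> k"
    using assms(1) by (intro dvd_imp_le) auto
  \<comment> \<open>The base case \<open>3 < 4\<close> corresponds to \<open>k = 3\<close>; the
    inequality fails for \<open>m = 1\<close>.\<close>
  moreover have "Suc m < 2 ^ m" if "2 \<le> m" for m
    using that by (induction m rule: nat_induct_at_least) auto
  from this[of "k - 1"] have "Suc (k - 1) < 2 ^ (k - 1)"
    using assms(1) by linarith
  ultimately show False
    by linarith
qed

end
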